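(* Let $n,m\ge1$ be integers, $0<\alpha<nm$ and $0<p\le1$. There is a constant $C>0$ such that for every weight $u$ on $\mathbb{R}^n$ and every $\vec f=(f_1,\dots,f_m)$, $$\int_{\mathbb{R}^n}|\mathcal{I}_\alpha\vec f(x)|^p\,u(x)\,dx\le C\int_{\mathbb{R}^n}|\mathcal{M}_\alpha\vec f(x)|^p\,Mu(x)\,dx.$$
   Context: A weight is a nonnegative measurable function on $\mathbb{R}^n$. Cubes have sides parallel to the axes. The multilinear fractional integral is $\mathcal{I}_\alpha\vec f(x)=\int_{(\mathbb{R}^n)^m}\frac{f_1(y_1)\cdots f_m(y_m)}{(|x-y_1|+\dots+|x-y_m|)^{mn-\alpha}}\,d\vec y$, for functions $f_i$ for which the integral converges (for instance Schwartz functions). $\mathcal{M}_\alpha\vec f(x)=\sup_{Q\ni x}|Q|^{\alpha/n}\prod_{i=1}^m\frac1{|Q|}\int_Q|f_i|$, and $Mf(x)=\sup_{Q\ni x}\frac1{|Q|}\int_Q|f|$ is the Hardy–Littlewood maximal operator; suprema are over all cubes $Q$ containing $x$. *)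

theory Defs
  imports "HOL-Analysis.Analysis"
begin

definition weight :: "(real^'n \<Rightarrow> real) \<Rightarrow> bool" where
  "weight u \<longleftrightarrow> u \<in> borel_measurable lebesgue \<and> (\<forall>x. 0 \<le> u x)"

text \<open>Closed, nondegenerate cubes with sides parallel to the axes.\<close>

definition cubes :: "(real^'n) set set" where
  "cubes = {Q. \<exists>a l. 0 < l \<and> Q = cbox a (\<chi> i. a $ i + l)}"

text \<open>
  Averages and maximal functions take values in \<open>[0, \<infinity>]\<close>, since no local integrability
  is assumed.
\<close>

definition average :: "(real^'n) set \<Rightarrow> (real^'n \<Rightarrow> 'a::real_normed_vector) \<Rightarrow> ennreal" where
  "average Q g = (\<integral>\<^sup>+y\<in>Q. ennreal (norm (g y)) \<partial>lebesgue) / emeasure lebesgue Q"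

definition HL_maximal :: "(real^'n \<Rightarrow> real) \<Rightarrow> real^'n \<Rightarrow> ennreal" where
  "HL_maximal g x = (SUP Q\<in>{Q\<in>cubes. x \<in> Q}. average Q g)"

text \<open>
  A vector of functions \<open>(f\<^sub>1, \<dots>, f\<^sub>m)\<close> is a sequence \<open>f\<close> of which only the entries
  \<open>f i\<close> with \<open>i < m\<close> are used.
\<close>

definition frac_maximal ::
  "nat \<Rightarrow> real \<Rightarrow> (nat \<Rightarrow> real^'n \<Rightarrow> complex) \<Rightarrow> real^'n \<Rightarrow> ennreal" where
  "frac_maximal m \<alpha> f x =
     (SUP Q\<in>{Q\<in>cubes. x \<in> Q}.
        ennreal (measure lebesgue Q powr (\<alpha> / real CARD('n))) * (\<Prod>i<m. average Q (f i)))"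

definition frac_integrand ::
  "nat \<Rightarrow> real \<Rightarrow> (nat \<Rightarrow> real^'n \<Rightarrow> complex) \<Rightarrow> real^'n \<Rightarrow> (nat \<Rightarrow> real^'n) \<Rightarrow> complex" where
  "frac_integrand m \<alpha> f x y =
     (\<Prod>i<m. f i (y i)) /
       complex_of_real ((\<Sum>i<m. norm (x - y i)) powr (real m * real CARD('n) - \<alpha>))"

text \<open>
  Lebesgue measure on \<open>(\<real>\<^sup>n)\<^sup>m\<close>, as the product of \<open>m\<close> copies of Lebesgue measure on
  \<open>\<real>\<^sup>n\<close>.
\<close>

abbreviation lebesgue_power :: "nat \<Rightarrow> (nat \<Rightarrow> real^'n) measure" where
  "lebesgue_power m \<equiv> Pi\<^sub>M {..<m} (\<lambda>_. lebesgue)"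

definition frac_integral ::
  "nat \<Rightarrow> real \<Rightarrow> (nat \<Rightarrow> real^'n \<Rightarrow> complex) \<Rightarrow> real^'n \<Rightarrow> complex" where
  "frac_integral m \<alpha> f x = (\<integral>y. frac_integrand m \<alpha> f x y \<partial>lebesgue_power m)"

text \<open>
  The Bochner integral is \<open>0\<close> by convention where the integrand is not integrable; this predicate
  makes that happen only on a null set of points \<open>x\<close>.
\<close>

definition frac_integral_converges ::
  "nat \<Rightarrow> real \<Rightarrow> (nat \<Rightarrow> real^'n \<Rightarrow> complex) \<Rightarrow> bool" where
  "frac_integral_converges m \<alpha> f \<longleftrightarrow>
     (AE x in lebesgue. integrable (lebesgue_power m) (frac_integrand m \<alpha> f x))"

text \<open>The power \<open>t\<^sup>p\<close> on \<open>[0, \<infinity>]\<close> for \<open>p > 0\<close>, with \<open>\<infinity>\<^sup>p = \<infinity>\<close>.\<close>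

definition epowr :: "ennreal \<Rightarrow> real \<Rightarrow> ennreal" where
  "epowr t p = (if t = \<infinity> then \<infinity> else ennreal (enn2real t powr p))"

end

theory Submission
  imports Defs
begin

text \<open>
  Up to a constant, \<open>|\<I>\<^sub>\<alpha> f|\<close> is dominated pointwise by the sum of
  \<open>|Q|^(\<alpha>/n) \<Prod>\<^sub>i \<langle>|f\<^sub>i|\<rangle>\<^sub>Q\<close> over the cells \<open>Q\<close> containing \<open>x\<close> of \<open>2^n\<close> shifted
  dyadic grids (the one-third trick). Since \<open>p \<le> 1\<close>, the \<open>p\<close>-th power may be moved inside the sum,
  and it remains to bound the sum of \<open>(|Q|^(\<alpha>/n) \<Prod>\<^sub>i \<langle>|f\<^sub>i|\<rangle>\<^sub>Q)^p u(Q)\<close> over a single grid.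
  Inside a cell \<open>P\<close> stop at the maximal subcells whose product of averages exceeds \<open>(2m)^m\<close> times
  that of \<open>P\<close>. By the weak type \<open>(1,1)\<close> inequality they fill at most half of \<open>P\<close>. The cells
  above them contribute a geometric series, at most a constant times
  \<open>(|P|^(\<alpha>/n) \<Prod>\<^sub>i \<langle>|f\<^sub>i|\<rangle>\<^sub>P)^p u(P)\<close>, and this is dominated by the integral of
  \<open>(\<M>\<^sub>\<alpha> f)^p M u\<close> over the other half of \<open>P\<close>. The stopped subcells are treated inductively.
\<close>

section \<open>Powers of extended nonnegative reals\<close>

lemma epowr_0 [simp]: "epowr 0 p = 0"
  by (simp add: epowr_def)

lemma epowr_top [simp]: "epowr top p = top"
  by (simp add: epowr_def)

lemma epowr_ennreal: "0 \<le> t \<Longrightarrow> epowr (ennreal t) p = ennreal (t powr p)"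
  by (simp add: epowr_def)

lemma epowr_mono:
  assumes "a \<le> b" "0 \<le> p"
  shows "epowr a p \<le> epowr b p"
proof (cases b)
  case (real r)
  then obtain s where "a = ennreal s" "0 \<le> s" "s \<le> r"
    using assms(1) by (cases a) (auto simp: top_unique)
  then show ?thesis
    using real assms(2) by (auto simp: epowr_ennreal intro!: ennreal_leI powr_mono2)
qed auto

lemma epowr_mult:
  assumes "0 < p"
  shows "epowr (a * b) p = epowr a p * epowr b p"
  by (cases a; cases b)
    (auto simp: epowr_ennreal powr_mult epowr_def ennreal_mult_top ennreal_top_mult
      simp flip: ennreal_mult)

lemma epowr_epowr_inverse:
  assumes "0 < p"
  shows "epowr (epowr a p) (1 / p) = a" "epowr (epowr a (1 / p)) p = a"
  using assms by (cases a; auto simp: epowr_ennreal powr_powr)+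

text \<open>For positive \<open>a\<close>, \<open>b\<close>, write the left side as
  \<open>(a + b) powr (p - 1) * (a + b)\<close>. As \<open>t powr (p - 1)\<close> is nonincreasing
  in \<open>t\<close>, the first factor may be replaced by \<open>a powr (p - 1)\<close> on
  \<open>a\<close> and by \<open>b powr (p - 1)\<close> on \<open>b\<close>.\<close>

lemma powr_add_le_add_powr:
  fixes a b p :: real
  assumes "0 \<le> a" "0 \<le> b" "0 < p" "p \<le> 1"
  shows "(a + b) powr p \<le> a powr p + b powr p"
proof (cases "a = 0 \<or> b = 0")
  case False
  then have pos: "0 < a" "0 < b" using assms by auto
  have "(a + b) powr (p - 1) * a \<le> a powr (p - 1) * a"
    and "(a + b) powr (p - 1) * b \<le> b powr (p - 1) * b"
    using pos assms by (auto intro!: mult_right_mono powr_mono2')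
  then have "(a + b) powr (p - 1) * (a + b) \<le> a powr (p - 1) * a + b powr (p - 1) * b"
    by (simp add: distrib_left)
  then show ?thesis
    using pos by (simp add: powr_mult_base mult.commute)
qed (use assms in auto)

lemma epowr_add_le:
  assumes "0 < p" "p \<le> 1"
  shows "epowr (a + b) p \<le> epowr a p + epowr b p"
  using assms
  by (cases a; cases b)
    (auto simp: epowr_ennreal intro!: ennreal_leI powr_add_le_add_powr simp flip: ennreal_plus)

lemma epowr_sum_le:
  assumes "0 < p" "p \<le> 1"
  shows "epowr (\<Sum>i\<in>I. b i) p \<le> (\<Sum>i\<in>I. epowr (b i) p)"
  by (induction I rule: infinite_finite_induct)
    (auto intro: order_trans[OF epowr_add_le[OF assms]] add_left_mono)

text \<open>Finite subadditivity bounds every partial sum of \<open>b\<close> by the power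
  \<open>1 / p\<close> of the right side. Passing to the supremum there and raising to the power
  \<open>p\<close> again avoids a continuity argument.\<close>

lemma epowr_suminf_le:
  assumes "0 < p" "p \<le> 1"
  shows "epowr (\<Sum>i. b i) p \<le> (\<Sum>i. epowr (b i) p)"
proof -
  let ?S = "\<Sum>i. epowr (b i) p"
  have "(\<Sum>i<n. b i) \<le> epowr ?S (1 / p)" for n
  proof -
    have "epowr (\<Sum>i<n. b i) p \<le> ?S"
      by (rule order_trans[OF epowr_sum_le[OF assms]])
        (auto intro!: sum_le_suminf)
    from epowr_mono[OF this, of "1 / p"] show ?thesis
      using assms by (simp add: epowr_epowr_inverse)
  qed
  then have "(\<Sum>i. b i) \<le> epowr ?S (1 / p)"
    by (intro suminf_le_const) auto
  from epowr_mono[OF this, of p] show ?thesis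
    using assms by (simp add: epowr_epowr_inverse)
qed

lemma borel_measurable_epowr [measurable]:
  assumes "f \<in> borel_measurable M"
  shows "(\<lambda>x. epowr (f x) p) \<in> borel_measurable M"
  using assms unfolding epowr_def by measurable

section \<open>Nested partitions and the Carleson embedding\<close>

lemma set_nn_integral_eq_emeasure_density:
  assumes "h \<in> borel_measurable M" "S \<in> sets M"
  shows "(\<integral>\<^sup>+x\<in>S. h x \<partial>M) = emeasure (density M h) S"
  using assms by (simp add: emeasure_density)

text \<open>\<open>Q k x\<close> is the cell of generation \<open>k\<close> containing \<open>x\<close>; cells grow with \<open>k\<close>.\<close>

locale nested_cells =
  fixes M :: "'a measure" and Q :: "int \<Rightarrow> 'a \<Rightarrow> 'a set"
  assumes self_in_cell: "x \<in> Q k x"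
    and cell_eq: "y \<in> Q k x \<Longrightarrow> Q k y = Q k x"
    and cell_mono_Suc: "Q k x \<subseteq> Q (k + 1) x"
    and sets_cell [measurable]: "Q k x \<in> sets M"
    and countable_cells: "countable (range (Q k))"
    and emeasure_cell_pos: "emeasure M (Q k x) \<noteq> 0"
    and emeasure_cell_finite: "emeasure M (Q k x) \<noteq> \<infinity>"
    and space_eq: "space M = UNIV"
begin

definition avg :: "('a \<Rightarrow> ennreal) \<Rightarrow> int \<Rightarrow> 'a \<Rightarrow> ennreal" where
  "avg h k x = (\<integral>\<^sup>+y\<in>Q k x. h y \<partial>M) / emeasure M (Q k x)"

lemma avg_times_emeasure: "avg h k x * emeasure M (Q k x) = (\<integral>\<^sup>+y\<in>Q k x. h y \<partial>M)"
  unfolding avg_def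
  using emeasure_cell_pos emeasure_cell_finite
  by (simp add: ennreal_divide_times ennreal_divide_self top.not_eq_extremum)

lemma cell_mono: "j \<le> k \<Longrightarrow> Q j x \<subseteq> Q k x"
  by (induction k rule: int_ge_induct) (use cell_mono_Suc in blast)+

lemma cell_subset: "y \<in> Q k x \<Longrightarrow> j \<le> k \<Longrightarrow> Q j y \<subseteq> Q k x"
  using cell_mono cell_eq by blast

lemma avg_cong: "y \<in> Q k x \<Longrightarrow> avg h k y = avg h k x"
  by (simp add: avg_def cell_eq)

text \<open>Every preimage under \<open>h\<close> is a union of cells of generation
  \<open>k\<close>, of which there are only countably many.\<close>

lemma measurable_cell_constant:
  assumes "\<And>x y. y \<in> Q k x \<Longrightarrow> h y = h x" "range h \<subseteq> space N"
  shows "h \<in> measurable M N"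
proof (rule measurableI)
  show "h x \<in> space N" for x using assms(2) by auto
  fix S assume "S \<in> sets N"
  have "h -` S \<inter> space M = \<Union> {R \<in> range (Q k). R \<subseteq> h -` S}"
    using assms(1) self_in_cell by (fastforce simp: space_eq)
  moreover have "\<dots> \<in> sets M"
    by (rule sets.countable_Union)
      (auto intro: countable_subset[OF _ countable_cells])
  ultimately show "h -` S \<inter> space M \<in> sets M" by simp
qed

lemma borel_measurable_avg [measurable]: "avg h k \<in> borel_measurable M"
  by (rule measurable_cell_constant[of k]) (auto dest: avg_cong)

text \<open>\<open>P\<close> is a countable disjoint union of cells of generation \<open>k\<close>,
  over which the inequality is added. This carries estimates from cells to their parent, and in the
  end to the whole space.\<close>

lemma nn_integral_mono_of_cells:
  assumes [measurable]: "h1 \<in> borel_measurable M" "h2 \<in> borel_measurable M" "P \<in> sets M"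
    and sub: "\<And>x. x \<in> P \<Longrightarrow> Q k x \<subseteq> P"
    and le: "\<And>x. x \<in> P \<Longrightarrow> (\<integral>\<^sup>+y\<in>Q k x. h1 y \<partial>M) \<le> (\<integral>\<^sup>+y\<in>Q k x. h2 y \<partial>M)"
  shows "(\<integral>\<^sup>+y\<in>P. h1 y \<partial>M) \<le> (\<integral>\<^sup>+y\<in>P. h2 y \<partial>M)"
proof -
  let ?C = "Q k ` P"
  have P: "P = \<Union> ?C" using sub self_in_cell by blast
  have C: "countable ?C" by (rule countable_subset[OF _ countable_cells[of k]]) auto
  have D: "disjoint_family_on (\<lambda>R. R) ?C"
    unfolding disjoint_family_on_def using cell_eq by blast
  have *: "(\<integral>\<^sup>+y\<in>P. h y \<partial>M) = (\<integral>\<^sup>+R. (\<integral>\<^sup>+y\<in>R. h y \<partial>M) \<partial>count_space ?C)"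
    if [measurable]: "h \<in> borel_measurable M" for h
  proof -
    have "(\<integral>\<^sup>+y\<in>P. h y \<partial>M) = emeasure (density M h) (\<Union>R\<in>?C. R)"
      using P by (simp add: set_nn_integral_eq_emeasure_density)
    also have "\<dots> = (\<integral>\<^sup>+R. emeasure (density M h) R \<partial>count_space ?C)"
      by (rule emeasure_UN_countable[OF _ C D]) auto
    also have "\<dots> = (\<integral>\<^sup>+R. (\<integral>\<^sup>+y\<in>R. h y \<partial>M) \<partial>count_space ?C)"
      by (rule nn_integral_cong) (auto simp: emeasure_density)
    finally show ?thesis .
  qed
  show ?thesis
    unfolding *[OF assms(1)] *[OF assms(2)]
    by (rule nn_integral_mono) (use le in auto)
qed

section \<open>Weak type inequality and exceptional sets filling at most half of a cell\<close>

text \<open>Induction on the top generation. If the average over the top cell exceeds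
  \<open>t\<close>, its integral pays for the whole cell; otherwise the bad set is the union of the
  bad sets of the subcells. The start \<open>k = j - 1\<close> has no generations at all.\<close>

lemma weak_type:
  assumes [measurable]: "h \<in> borel_measurable M" and "j - 1 \<le> k"
  shows "t * emeasure M {y \<in> Q k x. \<exists>r\<in>{j..k}. t < avg h r y} \<le> (\<integral>\<^sup>+y\<in>Q k x. h y \<partial>M)"
  using \<open>j - 1 \<le> k\<close>
proof (induction k arbitrary: x rule: int_ge_induct)
  case base
  then show ?case by simp
next
  case (step k)
  let ?P = "Q (k + 1) x"
  let ?E = "\<lambda>k. {y. \<exists>r\<in>{j..k}. t < avg h r y}"
  have E [measurable]: "?E k \<in> sets M" for k
  proof -
    have "{y \<in> space M. \<exists>r\<in>{j..k}. t < avg h r y} \<in> sets M" by measurable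
    then show ?thesis by (simp add: space_eq)
  qed
  \<comment> \<open>As an integral of \<open>t\<close> times an indicator, the left side can be
    added over subcells.\<close>
  have ind: "t * emeasure M {y \<in> Q k z. \<exists>r\<in>{j..k'}. t < avg h r y}
      = (\<integral>\<^sup>+y\<in>Q k z. t * indicator (?E k') y \<partial>M)" for k k' z
  proof -
    have "(\<integral>\<^sup>+y\<in>Q k z. t * indicator (?E k') y \<partial>M)
        = (\<integral>\<^sup>+y. t * indicator {y \<in> Q k z. \<exists>r\<in>{j..k'}. t < avg h r y} y \<partial>M)"
      by (rule nn_integral_cong) (auto split: split_indicator)
    also have "\<dots> = t * emeasure M {y \<in> Q k z. \<exists>r\<in>{j..k'}. t < avg h r y}"
    proof (rule nn_integral_cmult_indicator)
      have "{y \<in> Q k z. \<exists>r\<in>{j..k'}. t < avg h r y} = Q k z \<inter> ?E k'" by auto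
      then show "{y \<in> Q k z. \<exists>r\<in>{j..k'}. t < avg h r y} \<in> sets M" by simp
    qed
    finally show ?thesis by simp
  qed
  show ?case
  proof (cases "t < avg h (k + 1) x")
    case True
    have "t * emeasure M {y \<in> ?P. \<exists>r\<in>{j..k + 1}. t < avg h r y} \<le> t * emeasure M ?P"
      by (intro mult_left_mono emeasure_mono) auto
    also have "\<dots> \<le> avg h (k + 1) x * emeasure M ?P"
      using True by (intro mult_right_mono) auto
    finally show ?thesis by (simp add: avg_times_emeasure)
  next
    case False
    \<comment> \<open>Generation \<open>k + 1\<close> drops out: its average is constant on
      \<open>?P\<close> and does not exceed \<open>t\<close>.\<close>
    then have "{y \<in> ?P. \<exists>r\<in>{j..k + 1}. t < avg h r y} = {y \<in> ?P. \<exists>r\<in>{j..k}. t < avg h r y}"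
      by (auto simp: avg_cong order_le_less intro: zle_add1_eq_le[THEN iffD1])
        (metis avg_cong atLeastAtMost_iff add1_zle_eq order_le_less)+
    moreover have "(\<integral>\<^sup>+y\<in>?P. t * indicator (?E k) y \<partial>M) \<le> (\<integral>\<^sup>+y\<in>?P. h y \<partial>M)"
      by (rule nn_integral_mono_of_cells[of _ _ _ k])
        (use step.IH cell_subset[of _ "k + 1" x k] in \<open>auto simp: ind\<close>)
    ultimately show ?thesis by (simp add: ind)
  qed
qed

text \<open>If a product of \<open>m\<close> averages exceeds \<open>(2 * m) ^ m\<close> times the
  product over the top cell, some factor exceeds \<open>2 * m\<close> times its own average there.
  By \<open>weak_type\<close> each of these \<open>m\<close> events fills at most the fraction
  1/(2m) of the cell, so together at most half.\<close>

lemma sparse_exceptional_set: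
  fixes g :: "nat \<Rightarrow> 'a \<Rightarrow> ennreal"
  assumes [measurable]: "\<And>i. i < m \<Longrightarrow> g i \<in> borel_measurable M" and "0 < m" "j \<le> k + 1"
    and avg: "\<And>i. i < m \<Longrightarrow> avg (g i) k x \<noteq> 0" "\<And>i. i < m \<Longrightarrow> avg (g i) k x \<noteq> \<infinity>"
    and E [measurable]: "E \<in> sets M"
    and sub: "\<And>y. y \<in> E \<Longrightarrow> y \<in> Q k x \<Longrightarrow>
      \<exists>r\<in>{j..k}. of_nat (2 * m) ^ m * (\<Prod>i<m. avg (g i) k x) < (\<Prod>i<m. avg (g i) r y)"
  shows "emeasure M (Q k x) \<le> 2 * emeasure M (Q k x - E)"
proof -
  define P where "P = Q k x"
  have [measurable]: "P \<in> sets M" by (simp add: P_def)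
  have P: "emeasure M P \<noteq> \<infinity>" using emeasure_cell_finite by (simp add: P_def)
  define c where "c i = avg (g i) k x" for i
  define D where "D i = {y \<in> P. \<exists>r\<in>{j..k}. of_nat (2 * m) * c i < avg (g i) r y}" for i
  have D [measurable]: "D i \<in> sets M" if "i < m" for i
  proof -
    have "{y \<in> space M. \<exists>r\<in>{j..k}. of_nat (2 * m) * c i < avg (g i) r y} \<in> sets M"
      by measurable
    moreover have "D i = P \<inter> {y \<in> space M. \<exists>r\<in>{j..k}. of_nat (2 * m) * c i < avg (g i) r y}"
      by (auto simp: D_def space_eq)
    ultimately show ?thesis by simp
  qed
  have cover: "P \<inter> E \<subseteq> (\<Union>i<m. D i)"
  proof
    fix y assume y: "y \<in> P \<inter> E"
    then obtain r where r: "r \<in> {j..k}"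
      and lt: "of_nat (2 * m) ^ m * (\<Prod>i<m. c i) < (\<Prod>i<m. avg (g i) r y)"
      using sub[of y] unfolding P_def c_def by blast
    have "\<exists>i<m. of_nat (2 * m) * c i < avg (g i) r y"
    proof (rule ccontr)
      assume "\<not> ?thesis"
      then have "avg (g i) r y \<le> of_nat (2 * m) * c i" if "i < m" for i
        using that by (meson not_less)
      then have "(\<Prod>i<m. avg (g i) r y) \<le> (\<Prod>i<m. of_nat (2 * m) * c i)"
        by (intro prod_mono_ennreal) blast
      also have "\<dots> = of_nat (2 * m) ^ m * (\<Prod>i<m. c i)"
        by (simp add: prod.distrib)
      finally show False using lt by simp
    qed
    then show "y \<in> (\<Union>i<m. D i)" using r y unfolding D_def by blast
  qed
  have meas_D: "of_nat (2 * m) * emeasure M (D i) \<le> emeasure M P" if "i < m" for i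
  proof -
    have "of_nat (2 * m) * c i * emeasure M (D i) \<le> c i * emeasure M P"
      using weak_type[of "g i" j k "of_nat (2 * m) * c i" x] that \<open>j \<le> k + 1\<close>
      by (simp add: D_def P_def c_def avg_times_emeasure)
    then have "c i * (of_nat (2 * m) * emeasure M (D i)) \<le> c i * emeasure M P"
      by (simp add: mult_ac)
    \<comment> \<open>Cancelling \<open>c i\<close> is where the averages must be neither zero nor
      infinite.\<close>
    then show ?thesis
      using avg[OF that] by (subst (asm) ennreal_mult_le_mult_iff) (auto simp: c_def)
  qed
  have "of_nat m * (2 * emeasure M (P \<inter> E)) \<le> of_nat m * (2 * (\<Sum>i<m. emeasure M (D i)))"
    by (intro mult_left_mono order_trans[OF emeasure_mono[OF cover]] emeasure_subadditive_finite)
      auto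
  also have "\<dots> = (\<Sum>i<m. of_nat (2 * m) * emeasure M (D i))"
    by (simp add: sum_distrib_left mult_ac)
  also have "\<dots> \<le> (\<Sum>i<m. emeasure M P)"
    by (intro sum_mono meas_D) auto
  also have "\<dots> = of_nat m * emeasure M P" by simp
  finally have half: "2 * emeasure M (P \<inter> E) \<le> emeasure M P"
    using \<open>0 < m\<close> by (subst (asm) ennreal_mult_le_mult_iff) auto
  have "emeasure M P = emeasure M (P \<inter> E) + emeasure M (P - E)"
    by (subst plus_emeasure) (auto intro: arg_cong[where f = "emeasure M"])
  then have "emeasure M P + emeasure M P = 2 * emeasure M (P \<inter> E) + 2 * emeasure M (P - E)"
    by (simp add: mult_2 add_ac)
  also have "\<dots> \<le> emeasure M P + 2 * emeasure M (P - E)"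
    using half by (rule add_right_mono)
  finally show ?thesis
    using P by (simp add: ennreal_add_left_cancel_le P_def)
qed

text \<open>
  A Carleson-type embedding. Part \<open>X\<close> of the induction is the stopping-time argument: below the
  threshold \<open>l\<close> the summands are controlled by the geometric growth of \<open>b\<close>, and where the
  threshold is exceeded the bound on smaller cells takes over. Applied on a cell with \<open>l\<close> a large
  multiple of the product of averages, the exceptional set fills at most half of the cell, so the
  first part is paid for by the integral of \<open>F\<close> over the complement.
\<close>

lemma carleson_embedding_cell:
  fixes g :: "nat \<Rightarrow> 'a \<Rightarrow> ennreal" and b :: "int \<Rightarrow> ennreal"
  assumes g [measurable]: "\<And>i. i < m \<Longrightarrow> g i \<in> borel_measurable M"
    and w [measurable]: "w \<in> borel_measurable M" and F [measurable]: "F \<in> borel_measurable M"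
    and "0 < m" "0 < p"
    and b: "\<And>k. b k \<noteq> 0" and sum_b: "\<And>j k. (\<Sum>r\<in>{j..k}. b r) \<le> B * b k"
    and F_ge: "\<And>k x. b k * epowr (\<Prod>i<m. avg (g i) k x) p * avg w k x \<le> F x"
    and "j - 1 \<le> k"
  shows "(\<integral>\<^sup>+y\<in>Q k x. (\<Sum>r\<in>{j..k}. b r * epowr (\<Prod>i<m. avg (g i) r y) p) * w y \<partial>M)
    \<le> (\<integral>\<^sup>+y\<in>Q k x. (2 * B * epowr (of_nat (2 * m) ^ m) p + 1) * F y \<partial>M)"
proof -
  define a where "a k x = (\<Prod>i<m. avg (g i) k x)" for k x
  define S where "S k y = (\<Sum>r\<in>{j..k}. b r * epowr (a r y) p)" for k y
  define s where "s k = (\<Sum>r\<in>{j..k}. b r)" for k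
  define E where "E l k = {y. \<exists>r\<in>{j..k}. l < a r y}" for l k
  define L :: ennreal where "L = of_nat (2 * m) ^ m"
  \<comment> \<open>The summand 1 keeps \<open>C\<close> nonzero, so that \<open>C * F y\<close> is
    infinite wherever \<open>F y\<close> is.\<close>
  define C where "C = 2 * B * epowr L p + 1"
  have [measurable]: "a k \<in> borel_measurable M" for k
    unfolding a_def by measurable
  have [measurable]: "S k \<in> borel_measurable M" for k
    unfolding S_def by measurable
  have [measurable]: "E l k \<in> sets M" for l k
  proof -
    have "{y \<in> space M. \<exists>r\<in>{j..k}. l < a r y} \<in> sets M" by measurable
    then show ?thesis by (simp add: space_eq E_def)
  qed
  have a_cong: "a k y = a k x" if "y \<in> Q k x" for k x y
    using that by (simp add: a_def avg_cong)
  have L: "1 \<le> L"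
  proof -
    have "1 \<le> (2 * m) ^ m" using \<open>0 < m\<close> by (intro one_le_power) auto
    then have "of_nat 1 \<le> (of_nat ((2 * m) ^ m) :: ennreal)" by (intro of_nat_mono)
    then show ?thesis by (simp add: L_def)
  qed
  \<comment> \<open>All thresholds \<open>l\<close> are needed: \<open>main (k + 1)\<close> uses
    \<open>X k\<close> on the subcells with a threshold taken from the parent cell. In turn
    \<open>X (k + 1)\<close> uses \<open>main (k + 1)\<close> where the threshold is
    exceeded.\<close>
  define X where "X k \<longleftrightarrow> (\<forall>x l. (\<integral>\<^sup>+y\<in>Q k x. S k y * w y \<partial>M)
      \<le> (\<integral>\<^sup>+y\<in>Q k x. s k * epowr l p * w y + C * F y * indicator (E l k) y \<partial>M))" for k
  define main where "main k \<longleftrightarrow> (\<forall>x. (\<integral>\<^sup>+y\<in>Q k x. S k y * w y \<partial>M)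
      \<le> (\<integral>\<^sup>+y\<in>Q k x. C * F y \<partial>M))" for k
  have "main k \<and> X k"
    using \<open>j - 1 \<le> k\<close>
  proof (induction k rule: int_ge_induct)
    case base
    show ?case by (simp add: main_def X_def S_def)
  next
    case (step k)
    have insert_k: "{j..k + 1} = insert (k + 1) {j..k}"
      using step.hyps by auto
    have S_Suc: "S (k + 1) y = b (k + 1) * epowr (a (k + 1) y) p + S k y" for y
      by (simp add: S_def insert_k)
    have s_Suc: "s (k + 1) = b (k + 1) + s k"
      by (simp add: s_def insert_k)
    \<comment> \<open>If the top cell does not exceed the threshold, its summand joins the geometric
      part, and \<open>X k\<close> handles the subcells.\<close>
    have below: "(\<integral>\<^sup>+y\<in>Q (k + 1) x. S (k + 1) y * w y \<partial>M)
        \<le> (\<integral>\<^sup>+y\<in>Q (k + 1) x. s (k + 1) * epowr l p * w y \<partial>M)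
          + (\<integral>\<^sup>+y\<in>Q (k + 1) x. C * F y * indicator (E l k) y \<partial>M)"
      if l: "a (k + 1) x \<le> l" for x l
    proof -
      let ?P = "Q (k + 1) x"
      have 1: "(\<integral>\<^sup>+y\<in>?P. S k y * w y \<partial>M)
          \<le> (\<integral>\<^sup>+y\<in>?P. s k * epowr l p * w y + C * F y * indicator (E l k) y \<partial>M)"
        by (rule nn_integral_mono_of_cells[of _ _ _ k])
          (use step.IH cell_subset[of _ "k + 1" x k] in \<open>auto simp: X_def\<close>)
      have "(\<integral>\<^sup>+y\<in>?P. S (k + 1) y * w y \<partial>M)
          = (\<integral>\<^sup>+y\<in>?P. b (k + 1) * epowr (a (k + 1) x) p * w y + S k y * w y \<partial>M)"
        by (intro nn_integral_cong)
          (auto simp: S_Suc a_cong distrib_right split: split_indicator)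
      also have "\<dots> = (\<integral>\<^sup>+y\<in>?P. b (k + 1) * epowr (a (k + 1) x) p * w y \<partial>M)
          + (\<integral>\<^sup>+y\<in>?P. S k y * w y \<partial>M)"
        by (simp add: distrib_right nn_integral_add)
      also have "\<dots> \<le> (\<integral>\<^sup>+y\<in>?P. b (k + 1) * epowr l p * w y \<partial>M)
          + (\<integral>\<^sup>+y\<in>?P. s k * epowr l p * w y + C * F y * indicator (E l k) y \<partial>M)"
        using \<open>0 < p\<close> l
        by (intro add_mono 1 nn_integral_mono mult_right_mono mult_left_mono epowr_mono) auto
      also have "\<dots> = (\<integral>\<^sup>+y\<in>?P. s (k + 1) * epowr l p * w y \<partial>M)
          + (\<integral>\<^sup>+y\<in>?P. C * F y * indicator (E l k) y \<partial>M)"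
        by (simp add: s_Suc distrib_right nn_integral_add add.assoc)
      finally show ?thesis .
    qed
    have "main (k + 1)"
      unfolding main_def
    proof
      fix x
      define P where "P = Q (k + 1) x"
      have [measurable]: "P \<in> sets M" by (simp add: P_def)
      define c where "c i = avg (g i) (k + 1) x" for i
      \<comment> \<open>The sparseness bound needs averages that are neither zero nor infinite. With
        a zero average, all products on subcells of \<open>P\<close> vanish. With an infinite one
        and no zeros, \<open>F\<close> is infinite on \<open>P\<close> unless \<open>w\<close>
        vanishes almost everywhere there.\<close>
      consider (zero) i where "i < m" "c i = 0"
        | (inf) i where "\<And>i. i < m \<Longrightarrow> c i \<noteq> 0" "i < m" "c i = \<infinity>"
        | (fin) "\<And>i. i < m \<Longrightarrow> c i \<noteq> 0" "\<And>i. i < m \<Longrightarrow> c i \<noteq> \<infinity>"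
        by blast
      then have "(\<integral>\<^sup>+y\<in>P. S (k + 1) y * w y \<partial>M) \<le> (\<integral>\<^sup>+y\<in>P. C * F y \<partial>M)"
      proof cases
        case zero
        have "avg (g i) r y = 0" if y: "y \<in> P" and r: "r \<le> k + 1" for y r
        proof -
          have "(\<integral>\<^sup>+z\<in>Q r y. g i z \<partial>M) \<le> (\<integral>\<^sup>+z\<in>P. g i z \<partial>M)"
            using cell_subset[OF y[unfolded P_def] r]
            by (intro nn_integral_mono) (auto simp: P_def split: split_indicator)
          also have "\<dots> = 0"
            using zero avg_times_emeasure[of "g i" "k + 1" x] by (simp add: c_def P_def)
          finally show ?thesis by (simp add: avg_def)
        qed
        then have "a r y = 0" if "y \<in> P" "r \<le> k + 1" for y r
          using that zero(1) by (auto simp: a_def)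
        then have "(\<integral>\<^sup>+y\<in>P. S (k + 1) y * w y \<partial>M) = (\<integral>\<^sup>+y. 0 \<partial>M)"
          by (intro nn_integral_cong) (auto simp: S_def split: split_indicator)
        then show ?thesis by simp
      next
        case inf
        then have top: "a (k + 1) x = \<infinity>"
          by (auto simp: a_def c_def ennreal_prod_eq_top)
        show ?thesis
        proof (cases "avg w (k + 1) x = 0")
          case True
          then have "(\<integral>\<^sup>+y\<in>P. w y \<partial>M) = 0"
            using avg_times_emeasure[of w "k + 1" x] by (simp add: P_def)
          then have "AE y in M. w y * indicator P y = 0"
            by (subst (asm) nn_integral_0_iff_AE) auto
          then have "AE y in M. S (k + 1) y * w y * indicator P y = 0"
            by eventually_elim (auto split: split_indicator)
          then have "(\<integral>\<^sup>+y\<in>P. S (k + 1) y * w y \<partial>M) = 0"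
            by (subst nn_integral_0_iff_AE) auto
          then show ?thesis by simp
        next
          case False
          have "F y = \<infinity>" if "y \<in> P" for y
          proof -
            have "b (k + 1) * epowr (a (k + 1) y) p * avg w (k + 1) y = \<infinity>"
              using that False top b
              by (simp add: P_def a_cong avg_cong ennreal_mult_top ennreal_top_mult)
            then show ?thesis using F_ge[of "k + 1" y] by (simp add: a_def top_unique)
          qed
          then have "(\<integral>\<^sup>+y\<in>P. C * F y \<partial>M) = (\<integral>\<^sup>+y. \<infinity> * indicator P y \<partial>M)"
            by (intro nn_integral_cong)
              (auto simp: C_def ennreal_mult_top split: split_indicator)
          also have "\<dots> = \<infinity>"
            using emeasure_cell_pos[of "k + 1" x]
            by (subst nn_integral_cmult_indicator) (auto simp: P_def ennreal_top_mult)
          finally show ?thesis by simp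
        qed
      next
        case fin
        \<comment> \<open>The factor \<open>L\<close> is exactly the one in
          \<open>sparse_exceptional_set\<close>.\<close>
        define l where "l = L * a (k + 1) x"
        have l: "a (k + 1) x \<le> l"
          using mult_right_mono[OF L, of "a (k + 1) x"] by (simp add: l_def)
        have sparse: "emeasure M P \<le> 2 * emeasure M (P - E l k)"
          unfolding P_def
        proof (rule sparse_exceptional_set[where g = g and m = m and j = j])
          show "\<exists>r\<in>{j..k + 1}. of_nat (2 * m) ^ m * (\<Prod>i<m. avg (g i) (k + 1) x)
              < (\<Prod>i<m. avg (g i) r y)" if "y \<in> E l k" for y
            using that unfolding E_def l_def L_def a_def insert_k by blast
        qed (use \<open>0 < m\<close> fin step.hyps in \<open>auto simp: c_def\<close>)
        have "(\<integral>\<^sup>+y\<in>P. s (k + 1) * epowr l p * w y \<partial>M)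
            = s (k + 1) * epowr l p * (avg w (k + 1) x * emeasure M P)"
          by (simp add: P_def avg_times_emeasure mult.assoc nn_integral_cmult)
        \<comment> \<open>Geometric growth reduces \<open>s (k + 1)\<close> to its last term, and
          sparseness trades \<open>P\<close> for twice the part outside \<open>E l k\<close>, where
          \<open>F\<close> can pay without being charged again on \<open>E l k\<close>.\<close>
        also have "\<dots> \<le> B * b (k + 1) * epowr l p
            * (avg w (k + 1) x * (2 * emeasure M (P - E l k)))"
          using sum_b[of j "k + 1"] sparse
          by (intro mult_mono) (auto simp: s_def)
        also have "\<dots> = 2 * B * epowr L p * (b (k + 1) * epowr (a (k + 1) x) p * avg w (k + 1) x)
            * emeasure M (P - E l k)"
          using \<open>0 < p\<close> by (simp add: l_def epowr_mult mult_ac)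
        also have "\<dots> = (\<integral>\<^sup>+y. 2 * B * epowr L p * (b (k + 1) * epowr (a (k + 1) x) p
            * avg w (k + 1) x) * indicator (P - E l k) y \<partial>M)"
          by (simp add: nn_integral_cmult_indicator)
        also have "\<dots> \<le> (\<integral>\<^sup>+y. C * F y * indicator (P - E l k) y \<partial>M)"
        proof (intro nn_integral_mono)
          fix y
          have "b (k + 1) * epowr (a (k + 1) x) p * avg w (k + 1) x \<le> F y" if "y \<in> P"
            using F_ge[of "k + 1" y] that by (simp add: P_def a_cong avg_cong flip: a_def)
          moreover have "2 * B * epowr L p \<le> C" by (simp add: C_def)
          ultimately show "2 * B * epowr L p * (b (k + 1) * epowr (a (k + 1) x) p
              * avg w (k + 1) x) * indicator (P - E l k) y
            \<le> C * F y * indicator (P - E l k) y"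
            by (auto split: split_indicator intro!: mult_mono)
        qed
        finally have "(\<integral>\<^sup>+y\<in>P. S (k + 1) y * w y \<partial>M)
            \<le> (\<integral>\<^sup>+y. C * F y * indicator (P - E l k) y \<partial>M)
              + (\<integral>\<^sup>+y\<in>P. C * F y * indicator (E l k) y \<partial>M)"
          using below[OF l] by (simp add: P_def) (meson add_right_mono order_trans)
        also have "\<dots> = (\<integral>\<^sup>+y. C * F y * indicator (P - E l k) y
            + C * F y * indicator (E l k) y * indicator P y \<partial>M)"
          by (subst nn_integral_add) auto
        also have "\<dots> = (\<integral>\<^sup>+y\<in>P. C * F y \<partial>M)"
          by (intro nn_integral_cong) (auto split: split_indicator)
        finally show ?thesis .
      qed
      then show "(\<integral>\<^sup>+y\<in>Q (k + 1) x. S (k + 1) y * w y \<partial>M) \<le> (\<integral>\<^sup>+y\<in>Q (k + 1) x. C * F y \<partial>M)"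
        by (simp add: P_def)
    qed
    moreover have "X (k + 1)"
      unfolding X_def
    proof (intro allI)
      fix x l
      let ?P = "Q (k + 1) x"
      let ?R = "\<integral>\<^sup>+y\<in>?P. s (k + 1) * epowr l p * w y + C * F y * indicator (E l (k + 1)) y \<partial>M"
      show "(\<integral>\<^sup>+y\<in>?P. S (k + 1) y * w y \<partial>M) \<le> ?R"
      \<comment> \<open>Above the threshold the whole cell lies in \<open>E l (k + 1)\<close>, so
        \<open>main (k + 1)\<close> suffices; otherwise \<open>below\<close> applies.\<close>
      proof (cases "l < a (k + 1) x")
        case True
        have "?P \<subseteq> E l (k + 1)"
          using True step.hyps by (auto simp: E_def a_cong intro!: bexI[of _ "k + 1"])
        then have "(\<integral>\<^sup>+y\<in>?P. C * F y \<partial>M) \<le> ?R"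
          by (intro nn_integral_mono) (auto split: split_indicator)
        with \<open>main (k + 1)\<close> show ?thesis
          unfolding main_def by (meson order_trans)
      next
        case False
        then have "(\<integral>\<^sup>+y\<in>?P. S (k + 1) y * w y \<partial>M)
            \<le> (\<integral>\<^sup>+y\<in>?P. s (k + 1) * epowr l p * w y \<partial>M)
              + (\<integral>\<^sup>+y\<in>?P. C * F y * indicator (E l k) y \<partial>M)"
          by (intro below) auto
        also have "\<dots> \<le> (\<integral>\<^sup>+y\<in>?P. s (k + 1) * epowr l p * w y \<partial>M)
              + (\<integral>\<^sup>+y\<in>?P. C * F y * indicator (E l (k + 1)) y \<partial>M)"
          by (intro add_left_mono nn_integral_mono)
            (auto simp: E_def insert_k split: split_indicator)
        also have "\<dots> = ?R"
          by (simp add: distrib_right nn_integral_add)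
        finally show ?thesis .
      qed
    qed
    ultimately show ?case by simp
  qed
  then show ?thesis
    by (simp add: main_def S_def a_def C_def L_def)
qed

text \<open>A partial sum involves finitely many generations. They fit into one range
  \<open>J\<close>, and the bound on cells of its top generation is added over these cells, which
  partition the space. The constant does not depend on \<open>J\<close>.\<close>

lemma carleson_embedding:
  fixes g :: "nat \<Rightarrow> 'a \<Rightarrow> ennreal" and b :: "int \<Rightarrow> ennreal"
  assumes g [measurable]: "\<And>i. i < m \<Longrightarrow> g i \<in> borel_measurable M"
    and w [measurable]: "w \<in> borel_measurable M" and F [measurable]: "F \<in> borel_measurable M"
    and "0 < m" "0 < p"
    and b: "\<And>k. b k \<noteq> 0" and sum_b: "\<And>j k. (\<Sum>r\<in>{j..k}. b r) \<le> B * b k"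
    and F_ge: "\<And>k x. b k * epowr (\<Prod>i<m. avg (g i) k x) p * avg w k x \<le> F x"
  shows "(\<Sum>n. \<integral>\<^sup>+y. b (int_decode n) * epowr (\<Prod>i<m. avg (g i) (int_decode n) y) p * w y \<partial>M)
    \<le> (2 * B * epowr (of_nat (2 * m) ^ m) p + 1) * (\<integral>\<^sup>+y. F y \<partial>M)"
proof (rule suminf_le_const)
  fix N
  let ?T = "\<lambda>r y. b r * epowr (\<Prod>i<m. avg (g i) r y) p"
  let ?C = "2 * B * epowr (of_nat (2 * m) ^ m) p + 1"
  obtain K where K: "\<And>n. n < N \<Longrightarrow> \<bar>int_decode n\<bar> \<le> K"
    using finite_imageI[of "{..<N}" "\<lambda>n. \<bar>int_decode n\<bar>"]
    by (metis (no_types, lifting) Max_ge finite_lessThan imageI lessThan_iff)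
  \<comment> \<open>The absolute values cover \<open>N = 0\<close>, where \<open>K\<close> may be
    negative.\<close>
  define J where "J = {-\<bar>K\<bar>..\<bar>K\<bar>}"
  have sub: "int_decode ` {..<N} \<subseteq> J"
    using K by (force simp: J_def)
  have "(\<Sum>n<N. \<integral>\<^sup>+y. ?T (int_decode n) y * w y \<partial>M)
      = (\<integral>\<^sup>+y. (\<Sum>n<N. ?T (int_decode n) y * w y) \<partial>M)"
    by (subst nn_integral_sum) auto
  also have "\<dots> = (\<integral>\<^sup>+y. (\<Sum>r\<in>int_decode ` {..<N}. ?T r y * w y) \<partial>M)"
    by (simp add: sum.reindex inj_int_decode)
  also have "\<dots> \<le> (\<integral>\<^sup>+y\<in>UNIV. (\<Sum>r\<in>J. ?T r y) * w y \<partial>M)"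
    using sub by (auto simp: sum_distrib_right J_def intro!: nn_integral_mono sum_mono2)
  also have "\<dots> \<le> (\<integral>\<^sup>+y\<in>UNIV. ?C * F y \<partial>M)"
  proof (rule nn_integral_mono_of_cells[where k = "\<bar>K\<bar>"])
    show "UNIV \<in> sets M" using sets.top[of M] by (simp add: space_eq)
    show "(\<integral>\<^sup>+y\<in>Q \<bar>K\<bar> x. (\<Sum>r\<in>J. ?T r y) * w y \<partial>M) \<le> (\<integral>\<^sup>+y\<in>Q \<bar>K\<bar> x. ?C * F y \<partial>M)" for x
      unfolding J_def
      by (rule carleson_embedding_cell[OF g w F \<open>0 < m\<close> \<open>0 < p\<close> b sum_b F_ge]) auto
  qed auto
  also have "\<dots> = ?C * (\<integral>\<^sup>+y. F y \<partial>M)"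
    by (simp add: nn_integral_cmult)
  finally show "(\<Sum>n<N. \<integral>\<^sup>+y. ?T (int_decode n) y * w y \<partial>M) \<le> ?C * (\<integral>\<^sup>+y. F y \<partial>M)" .
qed auto

end

section \<open>Shifted dyadic grids\<close>

text \<open>
  The dyadic grid of generation \<open>k\<close>, shifted by a third of the side length in the coordinates in
  \<open>\<sigma>\<close>. The sign alternating with \<open>k\<close> makes the shifted grids nested.
\<close>

definition grid_index :: "'n set \<Rightarrow> int \<Rightarrow> real^'n \<Rightarrow> 'n \<Rightarrow> int" where
  "grid_index \<sigma> k x c = \<lfloor>x $ c / 2 powi k - (if c \<in> \<sigma> then (- 1) powi k / 3 else 0)\<rfloor>"

definition grid_cell :: "'n set \<Rightarrow> int \<Rightarrow> real^'n \<Rightarrow> (real^'n) set" where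
  "grid_cell \<sigma> k x = {y. grid_index \<sigma> k y = grid_index \<sigma> k x}"

lemma powi_neg_one_cases: "(- 1) powi k = (1 :: real) \<or> (- 1) powi k = (- 1 :: real)"
  by (cases "even k") (auto simp: power_int_minus_left)

text \<open>This gives nestedness: the next index depends on x only through the present one. With
  the sign e equal to 1 or -1, the identity 2/3 = 1 - 1/3 turns x/2^(k+1) + e/3 into half of (x/2^k
  - e/3) + e, and adding the integer e commutes with the floor.\<close>

lemma grid_index_Suc:
  "grid_index \<sigma> (k + 1) x c
    = (grid_index \<sigma> k x c + (if c \<in> \<sigma> then \<lfloor>(- 1) powi k :: real\<rfloor> else 0)) div 2"
proof -
  define e :: real where "e = (- 1) powi k"
  have e: "of_int \<lfloor>e\<rfloor> = e"
    using powi_neg_one_cases[of k] unfolding e_def by (metis floor_of_int of_int_1 of_int_minus)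
  have power_Suc: "(2 :: real) powi (k + 1) = 2 * 2 powi k" "(- 1) powi (k + 1) = - e"
    by (simp_all add: e_def power_int_add_1)
  define z where "z = x $ c / 2 powi k - (if c \<in> \<sigma> then e / 3 else 0) + (if c \<in> \<sigma> then of_int \<lfloor>e\<rfloor> else 0)"
  have "x $ c / 2 powi (k + 1) - (if c \<in> \<sigma> then (- 1) powi (k + 1) / 3 else 0) = z / of_int 2"
    unfolding power_Suc by (simp add: z_def e field_simps)
  then have "grid_index \<sigma> (k + 1) x c = \<lfloor>z\<rfloor> div 2"
    unfolding grid_index_def by (simp only: floor_divide_real_eq_div)
  also have "\<lfloor>z\<rfloor> = grid_index \<sigma> k x c + (if c \<in> \<sigma> then \<lfloor>e\<rfloor> else 0)"
    by (simp add: z_def grid_index_def e_def)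
  finally show ?thesis by (simp add: e_def)
qed

definition grid_corner :: "'n set \<Rightarrow> int \<Rightarrow> real^'n \<Rightarrow> real^'n" where
  "grid_corner \<sigma> k x = (\<chi> c. 2 powi k *
    (of_int (grid_index \<sigma> k x c) + (if c \<in> \<sigma> then (- 1) powi k / 3 else 0)))"

text \<open>Cells are half-open cubes. The open cube gives the lower bound for their measure; the
  closed one has the same measure and is admissible in the maximal operators.\<close>

lemma grid_cell_sandwich:
  fixes x :: "real^'n"
  shows "box (grid_corner \<sigma> k x) (\<chi> c. grid_corner \<sigma> k x $ c + 2 powi k) \<subseteq> grid_cell \<sigma> k x"
    and "grid_cell \<sigma> k x \<subseteq> cbox (grid_corner \<sigma> k x) (\<chi> c. grid_corner \<sigma> k x $ c + 2 powi k)"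
proof -
  let ?a = "grid_corner \<sigma> k x"
  have *: "grid_index \<sigma> k y c = grid_index \<sigma> k x c
      \<longleftrightarrow> ?a $ c \<le> y $ c \<and> y $ c < ?a $ c + 2 powi k" for y c
    unfolding grid_index_def[of \<sigma> k y c] floor_eq_iff grid_corner_def
    by (simp add: field_simps)
  show "box ?a (\<chi> c. ?a $ c + 2 powi k) \<subseteq> grid_cell \<sigma> k x"
    by (auto simp: grid_cell_def fun_eq_iff mem_box_cart * less_imp_le)
  show "grid_cell \<sigma> k x \<subseteq> cbox ?a (\<chi> c. ?a $ c + 2 powi k)"
    by (auto simp: grid_cell_def fun_eq_iff mem_box_cart * less_imp_le)
qed

lemma sets_grid_cell: "grid_cell \<sigma> k x \<in> sets lebesgue"
proof -
  have "(\<lambda>y. grid_index \<sigma> k y c) \<in> measurable borel (count_space UNIV)" for c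
    unfolding grid_index_def by measurable
  then have "{y \<in> space borel. \<forall>c. grid_index \<sigma> k y c = grid_index \<sigma> k x c} \<in> sets borel"
    by measurable
  then show ?thesis
    by (simp add: grid_cell_def fun_eq_iff)
qed

lemma emeasure_cube:
  fixes a :: "real^'n"
  assumes "0 \<le> l"
  shows "emeasure lborel (cbox a (\<chi> c. a $ c + l)) = ennreal (l ^ CARD('n))"
    and "emeasure lborel (box a (\<chi> c. a $ c + l)) = ennreal (l ^ CARD('n))"
proof -
  have le: "a \<bullet> b \<le> (\<chi> c. a $ c + l) \<bullet> b" and eq: "((\<chi> c. a $ c + l) - a) \<bullet> b = l"
    if "b \<in> Basis" for b
    using that assms by (auto simp: Basis_vec_def inner_axis)
  show "emeasure lborel (cbox a (\<chi> c. a $ c + l)) = ennreal (l ^ CARD('n))"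
    using le by (simp add: emeasure_lborel_cbox_eq eq)
  show "emeasure lborel (box a (\<chi> c. a $ c + l)) = ennreal (l ^ CARD('n))"
    using le by (simp add: emeasure_lborel_box_eq eq)
qed

lemma emeasure_grid_cell:
  fixes x :: "real^'n"
  shows "emeasure lebesgue (grid_cell \<sigma> k x) = ennreal ((2 powi k) ^ CARD('n))"
proof (rule antisym)
  let ?a = "grid_corner \<sigma> k x"
  show "emeasure lebesgue (grid_cell \<sigma> k x) \<le> ennreal ((2 powi k) ^ CARD('n))"
    using emeasure_mono[OF grid_cell_sandwich(2)[of \<sigma> k x], of lebesgue] emeasure_cube(1)[of "2 powi k" ?a]
    by simp
  show "ennreal ((2 powi k) ^ CARD('n)) \<le> emeasure lebesgue (grid_cell \<sigma> k x)"
    using emeasure_mono[OF grid_cell_sandwich(1)[of \<sigma> k x] sets_grid_cell] emeasure_cube(2)[of "2 powi k" ?a]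
    by simp
qed

interpretation grid: nested_cells lebesgue "grid_cell \<sigma> :: int \<Rightarrow> real^'n \<Rightarrow> _" for \<sigma>
proof
  fix x y :: "real^'n" and k
  show "x \<in> grid_cell \<sigma> k x" by (simp add: grid_cell_def)
  show "grid_cell \<sigma> k y = grid_cell \<sigma> k x" if "y \<in> grid_cell \<sigma> k x"
    using that by (simp add: grid_cell_def)
  show "grid_cell \<sigma> k x \<subseteq> grid_cell \<sigma> (k + 1) x"
    by (auto simp: grid_cell_def fun_eq_iff grid_index_Suc)
  show "grid_cell \<sigma> k x \<in> sets lebesgue" by (rule sets_grid_cell)
  have "range (grid_cell \<sigma> k) \<subseteq> range (\<lambda>h. {y. grid_index \<sigma> k y = h})"
    by (auto simp: grid_cell_def)
  then show "countable (range (grid_cell \<sigma> k :: real^'n \<Rightarrow> _))"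
    by (rule countable_subset) (intro countable_image countableI_type)
  show "emeasure lebesgue (grid_cell \<sigma> k x) \<noteq> 0" "emeasure lebesgue (grid_cell \<sigma> k x) \<noteq> \<infinity>"
    by (auto simp: emeasure_grid_cell)
qed auto

lemma grid_cell_subset_cube:
  fixes x :: "real^'n"
  obtains R where "R \<in> cubes" "x \<in> R" "grid_cell \<sigma> k x \<subseteq> R"
    "emeasure lebesgue R = emeasure lebesgue (grid_cell \<sigma> k x)"
    "measure lebesgue R = (2 powi k) ^ CARD('n)"
proof -
  let ?a = "grid_corner \<sigma> k x"
  let ?R = "cbox ?a (\<chi> c. ?a $ c + 2 powi k)"
  have "?R \<in> cubes"
    unfolding cubes_def by (auto intro!: exI[of _ ?a] exI[of _ "2 powi k"])
  moreover have em: "emeasure lebesgue ?R = ennreal ((2 powi k) ^ CARD('n))"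
    using emeasure_cube(1)[of "2 powi k" ?a] by simp
  moreover from this have "measure lebesgue ?R = (2 powi k) ^ CARD('n)"
    unfolding measure_def by (simp add: enn2real_ennreal)
  moreover note sub = grid_cell_sandwich(2)[of \<sigma> k x]
  moreover have "x \<in> ?R" using sub grid.self_in_cell by blast
  ultimately show ?thesis
    by (intro that[of ?R]) (auto simp: emeasure_grid_cell)
qed

section \<open>The one-third trick\<close>

text \<open>The integers and their translate by \<open>e / 3\<close> are at distance 1/3, so an
  interval of length \<open>2 * D\<close> below 1/3 cannot meet both. The flag \<open>t\<close>
  selects one that it misses.\<close>

lemma floor_shift_third:
  fixes z D e :: real
  assumes "D < 1 / 6" "e = 1 \<or> e = - 1"
  shows "\<exists>t. \<forall>z'. \<bar>z' - z\<bar> \<le> D \<longrightarrow>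
    \<lfloor>z' - (if t then e / 3 else 0)\<rfloor> = \<lfloor>z - (if t then e / 3 else 0)\<rfloor>"
proof -
  \<comment> \<open>This places \<open>z\<close> in [j - 1/6, j + 5/6): either \<open>z\<close> is
    at least 1/6 away from all integers, or it is within 1/6 of \<open>j\<close> and the shifted
    grid is used.\<close>
  define j where "j = \<lfloor>z + 1 / 6\<rfloor>"
  have j: "of_int j \<le> z + 1 / 6" "z + 1 / 6 < of_int j + 1"
    unfolding j_def by linarith+
  have *: "\<lfloor>z' - v\<rfloor> = i" if "of_int i \<le> z' - v" "z' - v < of_int i + 1" for z' v i
    using that by (rule floor_unique)
  consider "1 / 6 \<le> z - j" | "z - j < 1 / 6" "e = 1" | "z - j < 1 / 6" "e = - 1"
    using assms(2) by linarith
  then show ?thesis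
  proof cases
    case 1
    then have "\<lfloor>z' - 0\<rfloor> = j" if "\<bar>z' - z\<bar> \<le> D" for z'
      using that assms(1) j by (intro *) linarith+
    moreover have "\<lfloor>z - 0\<rfloor> = j" using 1 j by (intro *) linarith+
    ultimately show ?thesis by (intro exI[of _ False]) simp
  next
    case 2
    then have "\<lfloor>z' - 1 / 3\<rfloor> = j - 1" if "\<bar>z' - z\<bar> \<le> D" for z'
      using that assms(1) j by (intro *; simp; linarith)
    moreover have "\<lfloor>z - 1 / 3\<rfloor> = j - 1" using 2 j by (intro *; simp; linarith)
    ultimately show ?thesis using 2 by (intro exI[of _ True]) simp
  next
    case 3
    then have "\<lfloor>z' - (- 1 / 3)\<rfloor> = j" if "\<bar>z' - z\<bar> \<le> D" for z'
      using that assms(1) j by (intro *; simp; linarith)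
    moreover have "\<lfloor>z - (- 1 / 3)\<rfloor> = j" using 3 j by (intro *; simp; linarith)
    ultimately show ?thesis using 3 by (intro exI[of _ True]) simp
  qed
qed

text \<open>The one-dimensional trick is applied in each coordinate separately; \<sigma> collects
  the coordinates that need the shift.\<close>

lemma grid_cell_cover:
  fixes x :: "real^'n"
  assumes "0 < D"
  shows "\<exists>\<sigma> k. 2 powi k \<le> 12 * D \<and> (\<forall>y. norm (x - y) \<le> D \<longrightarrow> y \<in> grid_cell \<sigma> k x)"
proof -
  \<comment> \<open>The generation with 6D < 2^k <= 12D; the strict inequality is the hypothesis
    \<open>D / 2 powi k < 1 / 6\<close> of the trick.\<close>
  define k where "k = \<lfloor>log 2 (6 * D)\<rfloor> + 1"
  have powi: "2 powi i = 2 powr real_of_int i" for i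
    by (simp add: powr_real_of_int')
  have "2 powr real_of_int k \<le> 2 powr (log 2 (6 * D) + 1)"
    unfolding k_def by (intro powr_mono) auto
  then have le: "2 powi k \<le> 12 * D"
    using assms by (simp add: powi powr_add)
  have "2 powr log 2 (6 * D) < 2 powr real_of_int k"
    unfolding k_def by (intro powr_less_mono) linarith+
  then have D: "D / 2 powi k < 1 / 6"
    using assms by (simp add: powi divide_simps)
  let ?e = "(- 1 :: real) powi k"
  have "\<exists>t. \<forall>z'. \<bar>z' - x $ c / 2 powi k\<bar> \<le> D / 2 powi k \<longrightarrow>
      \<lfloor>z' - (if t then ?e / 3 else 0)\<rfloor> = \<lfloor>x $ c / 2 powi k - (if t then ?e / 3 else 0)\<rfloor>" for c
    using floor_shift_third[OF D powi_neg_one_cases] .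
  then obtain t where t: "\<And>c z'. \<bar>z' - x $ c / 2 powi k\<bar> \<le> D / 2 powi k \<Longrightarrow>
      \<lfloor>z' - (if t c then ?e / 3 else 0)\<rfloor> = \<lfloor>x $ c / 2 powi k - (if t c then ?e / 3 else 0)\<rfloor>"
    by metis
  have "y \<in> grid_cell {c. t c} k x" if "norm (x - y) \<le> D" for y
  proof -
    have "\<bar>y $ c / 2 powi k - x $ c / 2 powi k\<bar> \<le> D / 2 powi k" for c
    proof -
      have "\<bar>y $ c - x $ c\<bar> \<le> D"
        using component_le_norm_cart[of "x - y" c] that by simp
      then have "\<bar>y $ c - x $ c\<bar> / 2 powi k \<le> D / 2 powi k"
        by (rule divide_right_mono) simp
      then show ?thesis by (simp add: abs_divide flip: diff_divide_distrib)
    qed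
    then show ?thesis
      using t by (simp add: grid_cell_def grid_index_def fun_eq_iff)
  qed
  with le show ?thesis by blast
qed

section \<open>Dyadic averages against the maximal operators\<close>

lemma avg_le_average:
  assumes "grid_cell \<sigma> k x \<subseteq> R" "emeasure lebesgue R = emeasure lebesgue (grid_cell \<sigma> k x)"
  shows "grid.avg \<sigma> (\<lambda>y. ennreal (norm (h y))) k x \<le> average R h"
  unfolding grid.avg_def average_def assms(2)
  using assms(1)
  by (intro divide_right_mono_ennreal nn_integral_mono) (auto split: split_indicator)

lemma avg_le_HL_maximal:
  assumes "\<And>y. 0 \<le> u y"
  shows "grid.avg \<sigma> (\<lambda>y. ennreal (u y)) k x \<le> HL_maximal u x"
proof -
  obtain R where R: "R \<in> cubes" "x \<in> R" "grid_cell \<sigma> k x \<subseteq> R"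
    "emeasure lebesgue R = emeasure lebesgue (grid_cell \<sigma> k x)"
    by (rule grid_cell_subset_cube)
  have "grid.avg \<sigma> (\<lambda>y. ennreal (u y)) k x \<le> average R u"
    using avg_le_average[OF R(3,4), of u] assms by simp
  also have "\<dots> \<le> HL_maximal u x"
    unfolding HL_maximal_def using R by (intro SUP_upper) auto
  finally show ?thesis .
qed

lemma avg_le_frac_maximal:
  fixes x :: "real^'n"
  shows "ennreal (2 powr (of_int k * \<alpha>)) * (\<Prod>i<m. grid.avg \<sigma> (\<lambda>y. ennreal (norm (f i y))) k x)
    \<le> frac_maximal m \<alpha> f x"
proof -
  obtain R where R: "R \<in> cubes" "x \<in> R" "grid_cell \<sigma> k x \<subseteq> R"
    "emeasure lebesgue R = emeasure lebesgue (grid_cell \<sigma> k x)"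
    "measure lebesgue R = (2 powi k) ^ CARD('n)"
    by (rule grid_cell_subset_cube)
  have "measure lebesgue R powr (\<alpha> / real CARD('n)) = 2 powr (of_int k * \<alpha>)"
    by (simp add: R(5) powr_powr flip: powr_real_of_int' powr_realpow)
  then have "ennreal (2 powr (of_int k * \<alpha>)) * (\<Prod>i<m. grid.avg \<sigma> (\<lambda>y. ennreal (norm (f i y))) k x)
      \<le> ennreal (measure lebesgue R powr (\<alpha> / real CARD('n))) * (\<Prod>i<m. average R (f i))"
    by (auto intro!: mult_left_mono prod_mono_ennreal avg_le_average R)
  also have "\<dots> \<le> frac_maximal m \<alpha> f x"
    unfolding frac_maximal_def using R by (intro SUP_upper) auto
  finally show ?thesis .
qed

section \<open>The pointwise dyadic bound\<close>

lemma suminf_int_decode_ge: "h k \<le> (\<Sum>n. h (int_decode n) :: ennreal)"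
  using sum_le_suminf[of "\<lambda>n. h (int_decode n)" "{int_encode k}"] by simp

text \<open>All \<open>y i\<close> lie within D, the sum of the distances, of \<open>x\<close>,
  hence in one cell of side at most 12D. As \<kappa> is positive, the kernel is at most
  \<open>12 powr \<kappa>\<close> times the coefficient of this one cell, and the other summands are
  nonnegative.\<close>

lemma norm_frac_integrand_le:
  fixes x :: "real^'n"
  assumes "\<alpha> < real CARD('n) * real m"
  defines "\<kappa> \<equiv> real m * real CARD('n) - \<alpha>"
  shows "ennreal (norm (frac_integrand m \<alpha> f x y))
    \<le> ennreal (12 powr \<kappa>) * (\<Sum>\<sigma>\<in>UNIV. \<Sum>n. ennreal (2 powr (- \<kappa> * of_int (int_decode n))) *
        (\<Prod>i<m. ennreal (norm (f i (y i))) * indicator (grid_cell \<sigma> (int_decode n) x) (y i)))"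
    (is "_ \<le> _ * (\<Sum>\<sigma>\<in>UNIV. \<Sum>n. ?T \<sigma> (int_decode n))")
proof -
  define D where "D = (\<Sum>i<m. norm (x - y i))"
  have \<kappa>: "0 < \<kappa>" using assms by (simp add: mult.commute)
  have "0 \<le> D" by (simp add: D_def sum_nonneg)
  have norm_eq: "norm (frac_integrand m \<alpha> f x y) = (\<Prod>i<m. norm (f i (y i))) / D powr \<kappa>"
    by (simp add: frac_integrand_def \<kappa>_def D_def norm_divide prod_norm)
  show ?thesis
  proof (cases "D = 0")
    \<comment> \<open>Here the denominator is \<open>0 powr \<kappa> = 0\<close>, and division by
      zero yields 0.\<close>
    case True
    then show ?thesis by (simp add: norm_eq)
  next
    case False
    with \<open>0 \<le> D\<close> have "0 < D" by simp
    then obtain \<sigma> k where k: "2 powi k \<le> 12 * D"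
      and cell: "\<And>z. norm (x - z) \<le> D \<Longrightarrow> z \<in> grid_cell \<sigma> k x"
      using grid_cell_cover[of D x] by blast
    have "y i \<in> grid_cell \<sigma> k x" if "i < m" for i
    proof (rule cell)
      show "norm (x - y i) \<le> D"
        unfolding D_def using that by (intro member_le_sum) auto
    qed
    then have T: "?T \<sigma> k = ennreal (2 powr (- \<kappa> * of_int k) * (\<Prod>i<m. norm (f i (y i))))"
      by (simp add: ennreal_mult prod_nonneg prod_ennreal)
    have "1 / D powr \<kappa> = D powr (- \<kappa>)"
      by (simp add: powr_minus_divide)
    also have "\<dots> \<le> (2 powi k / 12) powr (- \<kappa>)"
      using k \<kappa> by (intro powr_mono2') auto
    also have "\<dots> = 12 powr \<kappa> * 2 powr (- \<kappa> * of_int k)"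
      by (simp add: powr_divide powr_minus powr_powr mult.commute field_simps flip: powr_real_of_int')
    finally have "norm (frac_integrand m \<alpha> f x y)
        \<le> 12 powr \<kappa> * 2 powr (- \<kappa> * of_int k) * (\<Prod>i<m. norm (f i (y i)))"
      using mult_right_mono[of "1 / D powr \<kappa>" _ "\<Prod>i<m. norm (f i (y i))"]
      by (simp add: norm_eq prod_nonneg)
    then have "ennreal (norm (frac_integrand m \<alpha> f x y))
        \<le> ennreal (12 powr \<kappa> * (2 powr (- \<kappa> * of_int k) * (\<Prod>i<m. norm (f i (y i)))))"
      by (intro ennreal_leI) (simp add: mult.assoc)
    also have "\<dots> = ennreal (12 powr \<kappa>) * ?T \<sigma> k"
      unfolding T by (simp add: ennreal_mult prod_nonneg)
    also have "?T \<sigma> k \<le> (\<Sum>n. ?T \<sigma> (int_decode n))"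
      by (rule suminf_int_decode_ge)
    also have "\<dots> \<le> (\<Sum>\<sigma>\<in>UNIV. \<Sum>n. ?T \<sigma> (int_decode n))"
      by (rule member_le_sum) auto
    finally show ?thesis by (simp add: mult_left_mono)
  qed
qed

lemma sigma_finite_lebesgue: "sigma_finite_measure (lebesgue :: 'a::euclidean_space measure)"
proof
  obtain A :: "'a set set" where "countable A" "A \<subseteq> sets lborel" "\<Union>A = space lborel"
    "\<forall>a\<in>A. emeasure lborel a \<noteq> \<infinity>"
    using lborel.sigma_finite_countable by blast
  then show "\<exists>A. countable A \<and> A \<subseteq> sets (lebesgue :: 'a measure) \<and> \<Union>A = space lebesgue \<and>
      (\<forall>a\<in>A. emeasure lebesgue a \<noteq> \<infinity>)"
    by (intro exI[of _ A]) auto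
qed

text \<open>On each cell the majorant of the integrand separates the variables, so its integral is a
  product. Replacing integrals by averages contributes 2^(knm), which turns the coefficient
  2^(-k\<kappa>) into 2^(k\<alpha>).\<close>

lemma norm_frac_integral_le:
  fixes x :: "real^'n" and f :: "nat \<Rightarrow> real^'n \<Rightarrow> complex"
  assumes \<alpha>: "\<alpha> < real CARD('n) * real m"
    and f [measurable]: "\<And>i. i < m \<Longrightarrow> f i \<in> borel_measurable lebesgue"
  shows "ennreal (norm (frac_integral m \<alpha> f x))
    \<le> ennreal (12 powr (real m * real CARD('n) - \<alpha>)) *
      (\<Sum>\<sigma>\<in>UNIV. \<Sum>n. ennreal (2 powr (of_int (int_decode n) * \<alpha>)) *
        (\<Prod>i<m. grid.avg \<sigma> (\<lambda>y. ennreal (norm (f i y))) (int_decode n) x))"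
proof -
  interpret product_sigma_finite "\<lambda>_::nat. lebesgue :: (real^'n) measure"
    by (rule product_sigma_finite.intro) (rule sigma_finite_lebesgue)
  define \<kappa> where "\<kappa> = real m * real CARD('n) - \<alpha>"
  let ?g = "\<lambda>\<sigma> k i z. ennreal (norm (f i z)) * indicator (grid_cell \<sigma> k x) z"
  have g [measurable]: "?g \<sigma> k i \<in> borel_measurable lebesgue" if "i < m" for \<sigma> k i
    using that by measurable
  have gy [measurable]: "(\<lambda>y. \<Prod>i<m. ?g \<sigma> k i (y i)) \<in> borel_measurable (lebesgue_power m)" for \<sigma> k
  proof (rule borel_measurable_prod_ennreal)
    fix i assume "i \<in> {..<m}"
    then show "(\<lambda>y. ?g \<sigma> k i (y i)) \<in> borel_measurable (lebesgue_power m)"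
      using measurable_compose[OF measurable_component_singleton[of i "{..<m}" "\<lambda>_. lebesgue"] g[of i \<sigma> k]]
      by simp
  qed
  have "ennreal (norm (frac_integral m \<alpha> f x))
      \<le> (\<integral>\<^sup>+y. ennreal (norm (frac_integrand m \<alpha> f x y)) \<partial>lebesgue_power m)"
    unfolding frac_integral_def
    \<comment> \<open>At points \<open>x\<close> without integrability the left side is 0 by
      convention.\<close>
    by (cases "integrable (lebesgue_power m) (frac_integrand m \<alpha> f x)")
      (auto simp: integral_norm_bound_ennreal not_integrable_integral_eq)
  also have "\<dots> \<le> (\<integral>\<^sup>+y. ennreal (12 powr \<kappa>) * (\<Sum>\<sigma>\<in>UNIV. \<Sum>n.
      ennreal (2 powr (- \<kappa> * of_int (int_decode n))) * (\<Prod>i<m. ?g \<sigma> (int_decode n) i (y i)))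
      \<partial>lebesgue_power m)"
    unfolding \<kappa>_def by (intro nn_integral_mono norm_frac_integrand_le \<alpha>)
  also have "\<dots> = ennreal (12 powr \<kappa>) * (\<Sum>\<sigma>\<in>UNIV. \<Sum>n.
      ennreal (2 powr (- \<kappa> * of_int (int_decode n))) *
      (\<integral>\<^sup>+y. (\<Prod>i<m. ?g \<sigma> (int_decode n) i (y i)) \<partial>lebesgue_power m))"
    by (simp add: nn_integral_cmult nn_integral_sum nn_integral_suminf)
  also have "\<dots> = ennreal (12 powr \<kappa>) * (\<Sum>\<sigma>\<in>UNIV. \<Sum>n.
      ennreal (2 powr (- \<kappa> * of_int (int_decode n))) *
      (\<Prod>i<m. \<integral>\<^sup>+z. ?g \<sigma> (int_decode n) i z \<partial>lebesgue))"
    by (subst product_nn_integral_prod) auto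
  also have "\<dots> = ennreal (12 powr \<kappa>) * (\<Sum>\<sigma>\<in>UNIV. \<Sum>n.
      ennreal (2 powr (of_int (int_decode n) * \<alpha>)) *
      (\<Prod>i<m. grid.avg \<sigma> (\<lambda>y. ennreal (norm (f i y))) (int_decode n) x))"
  proof -
    have "ennreal (2 powr (- \<kappa> * of_int k)) * (\<Prod>i<m. \<integral>\<^sup>+z. ?g \<sigma> k i z \<partial>lebesgue)
        = ennreal (2 powr (of_int k * \<alpha>)) * (\<Prod>i<m. grid.avg \<sigma> (\<lambda>y. ennreal (norm (f i y))) k x)"
      for \<sigma> k
    proof -
      have "2 powr (- \<kappa> * of_int k) * ((2 powi k) ^ CARD('n)) ^ m = 2 powr (of_int k * \<alpha>)"
        by (simp add: \<kappa>_def powr_powr algebra_simps flip: powr_real_of_int' powr_realpow powr_add)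
      then have "ennreal (2 powr (- \<kappa> * of_int k)) * ennreal (((2 powi k) ^ CARD('n)) ^ m)
          = ennreal (2 powr (of_int k * \<alpha>))"
        by (simp flip: ennreal_mult)
      then show ?thesis
        by (simp add: prod.distrib emeasure_grid_cell mult_ac ennreal_power
            flip: grid.avg_times_emeasure) (simp add: mult.assoc[symmetric])
    qed
    then show ?thesis by simp
  qed
  finally show ?thesis by (simp add: \<kappa>_def)
qed

section \<open>Geometric growth and the final estimate\<close>

text \<open>The last term dominates up to a factor independent of \<open>j\<close>; this factor
  becomes \<open>B\<close> in the embedding.\<close>

lemma geometric_sum_le:
  fixes q :: real
  assumes "1 < q"
  shows "(\<Sum>r\<in>{j..k}. q powi r) \<le> q / (q - 1) * q powi k"
proof (cases "j - 1 \<le> k")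
  case True
  then show ?thesis
  proof (induction k rule: int_ge_induct)
    case base
    then show ?case using assms by simp
  next
    case (step k)
    have "{j..k + 1} = insert (k + 1) {j..k}" using step.hyps by auto
    then have "(\<Sum>r\<in>{j..k + 1}. q powi r) \<le> q powi (k + 1) + q / (q - 1) * q powi k"
      using step.IH by simp
    also have "\<dots> = q / (q - 1) * q powi (k + 1)"
    proof -
      have "q powi (k + 1) = q powi k * q" using assms by (simp add: power_int_add_1)
      then show ?thesis using assms by (simp add: field_simps)
    qed
    finally show ?case .
  qed
next
  case False
  then show ?thesis using assms by simp
qed

theorem theorem2p25:
  fixes m :: nat and \<alpha> p :: real
  assumes "1 \<le> m" and "0 < \<alpha>" and "\<alpha> < real CARD('n::finite) * real m"
    and "0 < p" and "p \<le> 1"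
  shows "\<exists>C::real. 0 < C \<and>
    (\<forall>(u :: real^'n \<Rightarrow> real) (f :: nat \<Rightarrow> real^'n \<Rightarrow> complex).
      weight u \<longrightarrow> (\<forall>i<m. f i \<in> borel_measurable lebesgue) \<longrightarrow>
      frac_integral_converges m \<alpha> f \<longrightarrow>
      (\<integral>\<^sup>+x. ennreal (cmod (frac_integral m \<alpha> f x) powr p * u x) \<partial>lebesgue)
        \<le> ennreal C * (\<integral>\<^sup>+x. epowr (frac_maximal m \<alpha> f x) p * HL_maximal u x \<partial>lebesgue))"
proof -
  \<comment> \<open>With this ratio, \<open>q powi k\<close> is the \<open>p\<close>-th power of
    2^(k\<alpha>), the size factor |Q|^(\<alpha>/n) of a cell.\<close>
  define q where "q = 2 powr (\<alpha> * p)"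
  define b where "b k = ennreal (q powi k)" for k
  define B where "B = ennreal (q / (q - 1))"
  define K where "K = 2 * B * epowr (of_nat (2 * m) ^ m) p + 1"
  define \<kappa> where "\<kappa> = real m * real CARD('n) - \<alpha>"
  \<comment> \<open>The factors come from the pointwise bound, the number of grids, and the
    embedding on each grid.\<close>
  define A where "A = epowr (ennreal (12 powr \<kappa>)) p * (of_nat (card (UNIV :: 'n set set)) * K)"
  have q: "1 < q" using assms by (simp add: q_def)
  have b_eq: "b k = epowr (ennreal (2 powr (of_int k * \<alpha>))) p" for k
    by (simp add: b_def q_def epowr_ennreal powr_powr mult_ac flip: powr_real_of_int')
  have b_nonzero: "b k \<noteq> 0" for k using q by (simp add: b_def)
  have sum_b: "(\<Sum>r\<in>{j..k}. b r) \<le> B * b k" for j k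
    using geometric_sum_le[OF q, of j k] q
    by (simp add: b_def B_def sum_ennreal ennreal_leI flip: ennreal_mult)
  have "of_nat (2 * m) ^ m = ennreal (real ((2 * m) ^ m))"
    by (metis ennreal_of_nat_eq_real_of_nat of_nat_power)
  then have "A < \<infinity>"
    by (auto simp: A_def K_def B_def epowr_ennreal ennreal_mult_less_top power_less_top_ennreal simp del: of_nat_mult)
  have "(\<integral>\<^sup>+x. ennreal (cmod (frac_integral m \<alpha> f x) powr p * u x) \<partial>lebesgue)
        \<le> A * (\<integral>\<^sup>+x. epowr (frac_maximal m \<alpha> f x) p * HL_maximal u x \<partial>lebesgue)"
    if u: "weight u" and f [measurable]: "\<And>i. i < m \<Longrightarrow> f i \<in> borel_measurable lebesgue"
    for u :: "real^'n \<Rightarrow> real" and f :: "nat \<Rightarrow> real^'n \<Rightarrow> complex"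
  proof -
    have [measurable]: "u \<in> borel_measurable lebesgue" and u_nonneg: "0 \<le> u x" for x
      using u by (auto simp: weight_def)
    define w where "w = (\<lambda>x. ennreal (u x))"
    have [measurable]: "w \<in> borel_measurable lebesgue" by (simp add: w_def)
    define g where "g i y = ennreal (norm (f i y))" for i y
    have [measurable]: "g i \<in> borel_measurable lebesgue" if "i < m" for i
      using that by (simp add: g_def[abs_def])
    define T where "T \<sigma> k x = b k * epowr (\<Prod>i<m. grid.avg \<sigma> (g i) k x) p" for \<sigma> k x
    have [measurable]: "T \<sigma> k \<in> borel_measurable lebesgue" for \<sigma> k
      unfolding T_def by measurable
    have T_eq: "T \<sigma> k x = epowr (ennreal (2 powr (of_int k * \<alpha>)) * (\<Prod>i<m. grid.avg \<sigma> (g i) k x)) p"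
      for \<sigma> k x
      using \<open>0 < p\<close> by (simp add: T_def b_eq epowr_mult)
    \<comment> \<open>The least function allowed in the embedding. A supremum over countably many
      generations, it is measurable, and it lies below the integrand on the right side.\<close>
    define F where "F \<sigma> x = (SUP k. T \<sigma> k x * grid.avg \<sigma> w k x)" for \<sigma> x
    have [measurable]: "F \<sigma> \<in> borel_measurable lebesgue" for \<sigma>
      unfolding F_def by measurable
    have F_le: "F \<sigma> x \<le> epowr (frac_maximal m \<alpha> f x) p * HL_maximal u x" for \<sigma> x
      unfolding F_def
    proof (rule SUP_least)
      fix k
      show "T \<sigma> k x * grid.avg \<sigma> w k x \<le> epowr (frac_maximal m \<alpha> f x) p * HL_maximal u x"
        unfolding T_eq g_def[abs_def] w_def
        using \<open>0 < p\<close> u_nonneg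
        by (intro mult_mono epowr_mono avg_le_frac_maximal avg_le_HL_maximal) auto
    qed
    have embedding: "(\<Sum>n. \<integral>\<^sup>+x. T \<sigma> (int_decode n) x * w x \<partial>lebesgue)
        \<le> K * (\<integral>\<^sup>+x. F \<sigma> x \<partial>lebesgue)" for \<sigma>
      unfolding T_def K_def
    proof (rule grid.carleson_embedding)
      show "b k * epowr (\<Prod>i<m. grid.avg \<sigma> (g i) k x) p * grid.avg \<sigma> w k x \<le> F \<sigma> x" for k x
        unfolding F_def T_def by (rule SUP_upper) auto
    qed (use \<open>1 \<le> m\<close> \<open>0 < p\<close> b_nonzero sum_b in auto)
    have "ennreal (cmod (frac_integral m \<alpha> f x) powr p * u x)
        \<le> epowr (ennreal (12 powr \<kappa>)) p * (\<Sum>\<sigma>\<in>UNIV. \<Sum>n. T \<sigma> (int_decode n) x * w x)" for x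
    proof -
      let ?t = "\<lambda>\<sigma> k. ennreal (2 powr (of_int k * \<alpha>)) * (\<Prod>i<m. grid.avg \<sigma> (g i) k x)"
      have "epowr (ennreal (cmod (frac_integral m \<alpha> f x))) p
          \<le> epowr (ennreal (12 powr \<kappa>) * (\<Sum>\<sigma>\<in>UNIV. \<Sum>n. ?t \<sigma> (int_decode n))) p"
        unfolding \<kappa>_def g_def[abs_def]
        using \<open>0 < p\<close> by (intro epowr_mono norm_frac_integral_le assms f) auto
      \<comment> \<open>The condition \<open>p \<le> 1\<close> enters here: the power moves inside
        both sums.\<close>
      also have "\<dots> \<le> epowr (ennreal (12 powr \<kappa>)) p * (\<Sum>\<sigma>\<in>UNIV. \<Sum>n. T \<sigma> (int_decode n) x)"
        unfolding epowr_mult[OF \<open>0 < p\<close>, of "ennreal (12 powr \<kappa>)"] T_eq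
        using assms
        by (intro mult_left_mono order_trans[OF epowr_sum_le] sum_mono epowr_suminf_le) auto
      finally have "epowr (ennreal (cmod (frac_integral m \<alpha> f x))) p * w x
          \<le> epowr (ennreal (12 powr \<kappa>)) p * (\<Sum>\<sigma>\<in>UNIV. \<Sum>n. T \<sigma> (int_decode n) x) * w x"
        by (rule mult_right_mono) simp
      then show ?thesis
        by (simp add: epowr_ennreal w_def u_nonneg ennreal_mult mult.assoc sum_distrib_right
            ennreal_suminf_multc)
    qed
    then have "(\<integral>\<^sup>+x. ennreal (cmod (frac_integral m \<alpha> f x) powr p * u x) \<partial>lebesgue)
        \<le> (\<integral>\<^sup>+x. epowr (ennreal (12 powr \<kappa>)) p
          * (\<Sum>\<sigma>\<in>UNIV. \<Sum>n. T \<sigma> (int_decode n) x * w x) \<partial>lebesgue)"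
      by (intro nn_integral_mono)
    also have "\<dots> = epowr (ennreal (12 powr \<kappa>)) p
        * (\<Sum>\<sigma>\<in>UNIV. \<Sum>n. \<integral>\<^sup>+x. T \<sigma> (int_decode n) x * w x \<partial>lebesgue)"
      by (simp add: nn_integral_cmult nn_integral_sum nn_integral_suminf
          del: ennreal_suminf_multc)
    also have "\<dots> \<le> epowr (ennreal (12 powr \<kappa>)) p * (\<Sum>\<sigma>\<in>(UNIV :: 'n set set). K *
        (\<integral>\<^sup>+x. epowr (frac_maximal m \<alpha> f x) p * HL_maximal u x \<partial>lebesgue))"
      by (intro mult_left_mono sum_mono order_trans[OF embedding] nn_integral_mono F_le) auto
    finally show ?thesis by (simp add: A_def mult.assoc)
  qed
  note bound = this
  \<comment> \<open>Adding 1 makes the real constant positive whatever \<open>A\<close> is.\<close>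
  have A_le: "A \<le> ennreal (enn2real A + 1)"
    using \<open>A < \<infinity>\<close> by (cases A) (auto intro!: ennreal_leI)
  show ?thesis
  proof (intro exI[of _ "enn2real A + 1"] conjI allI impI)
    show "0 < enn2real A + 1" by (simp add: add_nonneg_pos)
  next
    fix u :: "real^'n \<Rightarrow> real" and f :: "nat \<Rightarrow> real^'n \<Rightarrow> complex"
    assume "weight u" "\<forall>i<m. f i \<in> borel_measurable lebesgue"
    then show "(\<integral>\<^sup>+x. ennreal (cmod (frac_integral m \<alpha> f x) powr p * u x) \<partial>lebesgue)
        \<le> ennreal (enn2real A + 1)
          * (\<integral>\<^sup>+x. epowr (frac_maximal m \<alpha> f x) p * HL_maximal u x \<partial>lebesgue)"
      by (intro order_trans[OF bound mult_right_mono[OF A_le]]) auto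
  qed
qed

end
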